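(* For any finite group $G$ and any conjugacy classes $\mu,\nu,\tau\in\Lambda_G$, the generating function $h^{\tau}_{\mu,\nu}(\beta)=\sum_{r=0}^\infty h_\tau(\mu,\nu;r)\beta^r$ is a rational function of $\beta$ (i.e. this power series is the expansion at $\beta=0$ of a rational function).
   Context: $\Lambda_G$ is the set of conjugacy classes of the finite group $G$. For $r\ge 0$ and distinct points $q_0,\dots,q_{r+1}\in\mathbb CP^1$, $h_\tau(\mu,\nu;r)$ is the weighted number of principal $G$-bundles over $\mathbb CP^1\setminus\{q_0,\dots,q_{r+1}\}$, up to isomorphism and each counted with weight $1/\#\mathrm{Aut}$, whose holonomy around $q_0$ is in $\mu$, around $q_{r+1}$ is in $\nu$, and around each of $q_1,\dots,q_r$ is in $\tau$ (the classes may be trivial). Convention: loops around $q_1,\dots,q_{r+1}$ are taken in the positive direction and the loop around $q_0$ in the negative direction. Equivalently, $$h_\tau(\mu,\nu;r)=\frac1{\#G}\,\#\{(a,t_1,\dots,t_r,b)\in\mu\times\tau^r\times\nu:\ a=t_1t_2\cdots t_r\,b\}.$$ *)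

theory Defs
  imports "HOL-Analysis.FPS_Convergence" "HOL-Algebra.Group_Action"
begin

definition conjugation :: "('a, 'b) monoid_scheme \<Rightarrow> 'a \<Rightarrow> 'a \<Rightarrow> 'a" where
  "conjugation G = (\<lambda>g. \<lambda>x\<in>carrier G. g \<otimes>\<^bsub>G\<^esub> x \<otimes>\<^bsub>G\<^esub> inv\<^bsub>G\<^esub> g)"

definition conj_classes :: "('a, 'b) monoid_scheme \<Rightarrow> 'a set set" where
  "conj_classes G = orbits G (carrier G) (conjugation G)"

text \<open>
  Holonomy data of a principal \<open>G\<close>-bundle over the projective line punctured at
  \<open>q\<^sub>0, \<dots>, q\<^sub>r\<^sub>+\<^sub>1\<close>, together with a point in the fibre over the base point. The entries of a triple
  \<open>(a, [t\<^sub>1, \<dots>, t\<^sub>r], b)\<close> are the holonomies around \<open>q\<^sub>0\<close>, around \<open>q\<^sub>1, \<dots>, q\<^sub>r\<close>, and around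
  \<open>q\<^sub>r\<^sub>+\<^sub>1\<close>. The loop around \<open>q\<^sub>0\<close> runs in the negative direction and all others in the positive
  direction, so the relation in the fundamental group reads \<open>a = t\<^sub>1 \<cdots> t\<^sub>r b\<close>.
\<close>

definition holonomy_data ::
  "('a, 'b) monoid_scheme \<Rightarrow> 'a set \<Rightarrow> 'a set \<Rightarrow> 'a set \<Rightarrow> nat \<Rightarrow> ('a \<times> 'a list \<times> 'a) set" where
  "holonomy_data G \<tau> \<mu> \<nu> r =
     {(a, ts, b). a \<in> \<mu> \<and> length ts = r \<and> set ts \<subseteq> \<tau> \<and> b \<in> \<nu> \<and>
        a = foldr (\<otimes>\<^bsub>G\<^esub>) ts \<one>\<^bsub>G\<^esub> \<otimes>\<^bsub>G\<^esub> b}"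

definition hurwitz_number ::
  "('a, 'b) monoid_scheme \<Rightarrow> 'a set \<Rightarrow> 'a set \<Rightarrow> 'a set \<Rightarrow> nat \<Rightarrow> rat" where
  "hurwitz_number G \<tau> \<mu> \<nu> r =
     of_nat (card (holonomy_data G \<tau> \<mu> \<nu> r)) / of_nat (order G)"

definition hurwitz_gf ::
  "('a, 'b) monoid_scheme \<Rightarrow> 'a set \<Rightarrow> 'a set \<Rightarrow> 'a set \<Rightarrow> complex fps" where
  "hurwitz_gf G \<tau> \<mu> \<nu> = Abs_fps (\<lambda>r. of_rat (hurwitz_number G \<tau> \<mu> \<nu> r))"

text \<open>
  Isomorphism classes of bundles correspond to orbits of holonomy data under simultaneous
  conjugation (the change of the chosen point in the fibre), and the automorphism group of a
  bundle is the stabilizer of its holonomy data. The lemma \<open>hurwitz_number_eq_weighted_count\<close>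
  below recovers \<open>hurwitz_number\<close> as the count of these classes with weight \<open>1 / #Aut\<close>.
\<close>

definition conjugate_data ::
  "('a, 'b) monoid_scheme \<Rightarrow> ('a \<times> 'a list \<times> 'a) set \<Rightarrow> 'a \<Rightarrow> 'a \<times> 'a list \<times> 'a \<Rightarrow> 'a \<times> 'a list \<times> 'a"
where
  "conjugate_data G E = (\<lambda>g. \<lambda>(a, ts, b)\<in>E.
     (conjugation G g a, map (conjugation G g) ts, conjugation G g b))"

context group begin

lemma conj_closed:
  "g \<in> carrier G \<Longrightarrow> x \<in> carrier G \<Longrightarrow> conjugation G g x \<in> carrier G"
  by (simp add: conjugation_def)

lemma conj_mult:
  "g \<in> carrier G \<Longrightarrow> x \<in> carrier G \<Longrightarrow> y \<in> carrier G \<Longrightarrow>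
     conjugation G g (x \<otimes> y) = conjugation G g x \<otimes> conjugation G g y"
  by (simp add: conjugation_def m_assoc inv_solve_left)

lemma conj_conj:
  "g \<in> carrier G \<Longrightarrow> h \<in> carrier G \<Longrightarrow> x \<in> carrier G \<Longrightarrow>
     conjugation G g (conjugation G h x) = conjugation G (g \<otimes> h) x"
  by (simp add: conjugation_def m_assoc inv_mult_group)

lemma conj_one: "x \<in> carrier G \<Longrightarrow> conjugation G \<one> x = x"
  by (simp add: conjugation_def)

lemma conj_unit: "g \<in> carrier G \<Longrightarrow> conjugation G g \<one> = \<one>"
  by (simp add: conjugation_def)

lemma conj_class_subset: "K \<in> conj_classes G \<Longrightarrow> K \<subseteq> carrier G"
  unfolding conj_classes_def orbits_def orbit_def using conj_closed by auto

lemma conj_class_closed: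
  "K \<in> conj_classes G \<Longrightarrow> g \<in> carrier G \<Longrightarrow> x \<in> K \<Longrightarrow> conjugation G g x \<in> K"
  unfolding conj_classes_def orbits_def orbit_def using conj_conj by blast

lemma foldr_closed: "set ts \<subseteq> carrier G \<Longrightarrow> foldr (\<otimes>) ts \<one> \<in> carrier G"
  by (induction ts) auto

lemma conj_foldr:
  "g \<in> carrier G \<Longrightarrow> set ts \<subseteq> carrier G \<Longrightarrow>
     conjugation G g (foldr (\<otimes>) ts \<one>) = foldr (\<otimes>) (map (conjugation G g) ts) \<one>"
  by (induction ts) (simp_all add: conj_unit conj_mult foldr_closed)

lemma conjugate_data_action:
  fixes r :: nat
  assumes K: "\<mu> \<in> conj_classes G" "\<nu> \<in> conj_classes G" "\<tau> \<in> conj_classes G"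
  defines "E \<equiv> holonomy_data G \<tau> \<mu> \<nu> r"
  shows "group_action G E (conjugate_data G E)"
proof -
  note sub = K[THEN conj_class_subset]
  have closed: "conjugate_data G E g x \<in> E" if g: "g \<in> carrier G" and x: "x \<in> E" for g x
  proof -
    obtain a ts b where [simp]: "x = (a, ts, b)" by (cases x)
    have *: "a \<in> \<mu>" "length ts = r" "set ts \<subseteq> \<tau>" "b \<in> \<nu>" "a = foldr (\<otimes>) ts \<one> \<otimes> b"
      using x by (auto simp: E_def holonomy_data_def)
    have c: "set ts \<subseteq> carrier G" "b \<in> carrier G" using * sub by auto
    have "conjugation G g a = foldr (\<otimes>) (map (conjugation G g) ts) \<one> \<otimes> conjugation G g b"
      unfolding *(5) using g c by (simp add: conj_mult conj_foldr foldr_closed)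
    moreover have "conjugation G g a \<in> \<mu>" "conjugation G g b \<in> \<nu>"
      "set (map (conjugation G g) ts) \<subseteq> \<tau>"
      using * g K conj_class_closed by auto
    ultimately have "(conjugation G g a, map (conjugation G g) ts, conjugation G g b) \<in> E"
      using *(2) by (simp add: E_def holonomy_data_def)
    then show ?thesis using x by (simp add: conjugate_data_def)
  qed
  have comp: "conjugate_data G E g (conjugate_data G E h x) = conjugate_data G E (g \<otimes> h) x"
    if g: "g \<in> carrier G" "h \<in> carrier G" and x: "x \<in> E" for g h x
  proof -
    obtain a ts b where [simp]: "x = (a, ts, b)" by (cases x)
    have c: "a \<in> carrier G" "set ts \<subseteq> carrier G" "b \<in> carrier G"
      using x sub by (auto simp: E_def holonomy_data_def)
    have "conjugate_data G E h x = (conjugation G h a, map (conjugation G h) ts, conjugation G h b)"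
      using x by (simp add: conjugate_data_def)
    with closed[OF g(2) x] show ?thesis
      using x g c by (auto simp: conjugate_data_def conj_conj)
  qed
  have one: "conjugate_data G E \<one> x = x" if x: "x \<in> E" for x
  proof -
    obtain a ts b where [simp]: "x = (a, ts, b)" by (cases x)
    have c: "a \<in> carrier G" "set ts \<subseteq> carrier G" "b \<in> carrier G"
      using x sub by (auto simp: E_def holonomy_data_def)
    have "map (conjugation G \<one>) ts = ts"
      using c by (intro map_idI) (auto simp: conj_one)
    then show ?thesis using x c by (simp add: conjugate_data_def conj_one)
  qed
  have ext: "conjugate_data G E g \<in> extensional E" for g
    by (simp add: conjugate_data_def)
  have bij: "conjugate_data G E g \<in> Bij E" if g: "g \<in> carrier G" for g
  proof -
    have "bij_betw (conjugate_data G E g) E E"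
      by (rule bij_betw_byWitness[where f' = "conjugate_data G E (inv g)"])
         (use g closed comp one in auto)
    then show ?thesis using ext by (simp add: Bij_def)
  qed
  have "conjugate_data G E (g \<otimes> h) = compose E (conjugate_data G E g) (conjugate_data G E h)"
    if "g \<in> carrier G" "h \<in> carrier G" for g h
    by (rule extensionalityI[OF ext]) (use comp that in \<open>auto simp: compose_def\<close>)
  then have "conjugate_data G E \<in> hom G (BijGroup E)"
    using bij by (auto simp: hom_def BijGroup_def)
  then show ?thesis
    unfolding group_action_def group_hom_def group_hom_axioms_def
    using group_BijGroup by (auto intro: group_axioms)
qed

lemma hurwitz_number_eq_weighted_count:
  fixes r :: nat
  assumes fin: "finite (carrier G)"
    and K: "\<mu> \<in> conj_classes G" "\<nu> \<in> conj_classes G" "\<tau> \<in> conj_classes G"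
  defines "E \<equiv> holonomy_data G \<tau> \<mu> \<nu> r"
  shows "hurwitz_number G \<tau> \<mu> \<nu> r =
    (\<Sum>B\<in>orbits G E (conjugate_data G E).
       1 / of_nat (card (stabilizer G (conjugate_data G E) (SOME x. x \<in> B))))"
proof -
  interpret A: group_action G E "conjugate_data G E"
    unfolding E_def by (rule conjugate_data_action[OF K])
  note sub = K[THEN conj_class_subset]
  have "E \<subseteq> carrier G \<times> {ts. set ts \<subseteq> carrier G \<and> length ts = r} \<times> carrier G"
    using sub by (auto simp: E_def holonomy_data_def)
  then have finE: "finite E"
    by (rule finite_subset) (use fin finite_lists_length_eq in auto)
  have pos: "order G > 0" using fin by (simp add: order_gt_0_iff_finite)
  have term_eq: "1 / of_nat (card (stabilizer G (conjugate_data G E) (SOME x. x \<in> B)))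
      = (\<Sum>x\<in>B. 1 / of_nat (order G) :: rat)"
    if B: "B \<in> orbits G E (conjugate_data G E)" for B
  proof -
    obtain y where y: "y \<in> E" "B = orbit G (conjugate_data G E) y"
      using B by (auto simp: orbits_def)
    define z where "z = (SOME x. x \<in> B)"
    have zB: "z \<in> B"
      unfolding z_def using A.orbit_refl[OF y(1)] y(2) by (metis someI)
    have zE: "z \<in> E" using zB B A.orbits_coverture by blast
    have "orbit G (conjugate_data G E) z \<in> orbits G E (conjugate_data G E)"
      using zE unfolding orbits_def by blast
    with A.disjoint_union[OF B this] zB A.orbit_refl[OF zE]
    have "B = orbit G (conjugate_data G E) z" by blast
    then have "card B * card (stabilizer G (conjugate_data G E) z) = order G"
      using A.orbit_stabilizer_theorem[OF zE] by simp
    then have "of_nat (card B) * of_nat (card (stabilizer G (conjugate_data G E) z))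
        = (of_nat (order G) :: rat)"
      by (metis of_nat_mult)
    moreover from this pos
    have "of_nat (card (stabilizer G (conjugate_data G E) z)) \<noteq> (0 :: rat)"
      by (metis mult_zero_right of_nat_0_less_iff less_irrefl)
    ultimately show ?thesis
      using pos unfolding z_def[symmetric] by (simp add: frac_eq_eq)
  qed
  have "(\<Sum>B\<in>orbits G E (conjugate_data G E).
       1 / of_nat (card (stabilizer G (conjugate_data G E) (SOME x. x \<in> B))))
     = (\<Sum>B\<in>orbits G E (conjugate_data G E). \<Sum>x\<in>B. 1 / of_nat (order G) :: rat)"
    by (intro sum.cong refl term_eq)
  also have "\<dots> = (\<Sum>x\<in>E. 1 / of_nat (order G))"
    by (rule A.disjoint_sum[OF finE])
  also have "\<dots> = hurwitz_number G \<tau> \<mu> \<nu> r"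
    by (simp add: hurwitz_number_def E_def)
  finally show ?thesis by simp
qed

end

end

theory Submission
  imports Defs
begin

text \<open>
  Let \<open>v\<^sub>r x\<close> be the number of pairs \<open>(ts, b)\<close> with \<open>ts \<in> \<tau>\<^sup>r\<close>, \<open>b \<in> \<nu>\<close> and product \<open>x\<close>. Splitting off the
  first factor gives \<open>v\<^sub>r\<^sub>+\<^sub>1 x = (\<Sum>t\<in>\<tau>. v\<^sub>r (t\<^sup>-\<^sup>1 x))\<close>, so the generating functions of the \<open>v\<^sub>r x\<close>, for
  \<open>x\<close> in the group, solve a finite linear system \<open>V = c + \<beta> A V\<close> with constant \<open>c\<close> and \<open>A\<close>. Gaussian
  elimination only divides by series with constant term \<open>1\<close> and so stays within rational series.
\<close>

text \<open>The relation is cross-multiplied so that only polynomials and products occur. The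
  condition \<open>poly q 0 \<noteq> 0\<close> makes \<open>fps_of_poly q\<close> a unit, so the
  fraction has no pole at the origin.\<close>

definition rational_fps :: "'a::field fps \<Rightarrow> bool" where
  "rational_fps F \<longleftrightarrow> (\<exists>p q. poly q 0 \<noteq> 0 \<and> F * fps_of_poly q = fps_of_poly p)"

lemma rational_fps_of_poly: "rational_fps (fps_of_poly p)"
  unfolding rational_fps_def by (intro exI[of _ p] exI[of _ 1]) simp

lemma rational_fps_const: "rational_fps (fps_const c)"
  using rational_fps_of_poly[of "[:c:]"] by (simp add: fps_of_poly_const)

lemma rational_fps_X: "rational_fps fps_X"
  using rational_fps_of_poly[of "[:0, 1:]"] by simp

lemma rational_fps_add:
  assumes "rational_fps F" "rational_fps H"
  shows "rational_fps (F + H)"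
proof -
  obtain p q p' q' where *: "poly q 0 \<noteq> 0" "F * fps_of_poly q = fps_of_poly p"
    "poly q' 0 \<noteq> 0" "H * fps_of_poly q' = fps_of_poly p'"
    using assms unfolding rational_fps_def by blast
  have "(F + H) * fps_of_poly (q * q') =
      (F * fps_of_poly q) * fps_of_poly q' + (H * fps_of_poly q') * fps_of_poly q"
    by (simp add: fps_of_poly_mult algebra_simps)
  also have "\<dots> = fps_of_poly (p * q' + p' * q)"
    by (simp only: * fps_of_poly_mult fps_of_poly_add)
  finally show ?thesis
    unfolding rational_fps_def using * by (metis mult_eq_0_iff poly_mult)
qed

lemma rational_fps_mult:
  assumes "rational_fps F" "rational_fps H"
  shows "rational_fps (F * H)"
proof -
  obtain p q p' q' where *: "poly q 0 \<noteq> 0" "F * fps_of_poly q = fps_of_poly p"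
    "poly q' 0 \<noteq> 0" "H * fps_of_poly q' = fps_of_poly p'"
    using assms unfolding rational_fps_def by blast
  have "F * H * fps_of_poly (q * q') = (F * fps_of_poly q) * (H * fps_of_poly q')"
    by (simp add: fps_of_poly_mult algebra_simps)
  also have "\<dots> = fps_of_poly (p * p')"
    by (simp only: * fps_of_poly_mult)
  finally show ?thesis
    unfolding rational_fps_def using * by (metis mult_eq_0_iff poly_mult)
qed

lemma rational_fps_sum:
  assumes "\<And>x. x \<in> A \<Longrightarrow> rational_fps (f x)"
  shows "rational_fps (\<Sum>x\<in>A. f x)"
  using assms
  by (induction A rule: infinite_finite_induct)
     (auto intro: rational_fps_add rational_fps_const[of 0, simplified])

text \<open>Numerator and denominator change places. A nonzero constant term of \<open>F\<close>
  forces \<open>p\<close> not to vanish at the origin, which makes it a legitimate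
  denominator.\<close>

lemma rational_fps_inverse:
  assumes "rational_fps F" "fps_nth F 0 \<noteq> 0"
  shows "rational_fps (inverse F)"
proof -
  obtain p q where *: "poly q 0 \<noteq> 0" "F * fps_of_poly q = fps_of_poly p"
    using assms unfolding rational_fps_def by blast
  have "coeff p 0 = fps_nth F 0 * coeff q 0"
    using arg_cong[OF *(2), of "\<lambda>H. fps_nth H 0"] by simp
  then have "poly p 0 \<noteq> 0" using assms(2) *(1) by (simp add: poly_0_coeff_0)
  moreover have "inverse F * fps_of_poly p = (inverse F * F) * fps_of_poly q"
    by (simp add: *(2)[symmetric] mult.assoc)
  then have "inverse F * fps_of_poly p = fps_of_poly q"
    using assms by (simp add: inverse_mult_eq_1)
  ultimately show ?thesis unfolding rational_fps_def by blast
qed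

text \<open>Induction on the index set eliminates one unknown at a time, so \<open>c\<close> and
  \<open>A\<close> must stay arbitrary while \<open>V\<close> is fixed. Coefficients without
  constant term make every pivot \<open>1 - A s s\<close> a unit, and this condition survives each
  elimination.\<close>

lemma rational_fps_linear_system:
  fixes V :: "'i \<Rightarrow> 'a::field fps"
  assumes "finite S"
    and "\<And>x. x \<in> S \<Longrightarrow> V x = c x + (\<Sum>y\<in>S. A x y * V y)"
    and "\<And>x. x \<in> S \<Longrightarrow> rational_fps (c x)"
    and "\<And>x y. x \<in> S \<Longrightarrow> y \<in> S \<Longrightarrow> rational_fps (A x y)"
    and "\<And>x y. x \<in> S \<Longrightarrow> y \<in> S \<Longrightarrow> fps_nth (A x y) 0 = 0"
    and "x \<in> S"
  shows "rational_fps (V x)"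
  using assms
proof (induction S arbitrary: c A x rule: finite_induct)
  case empty
  then show ?case by simp
next
  case (insert s S)
  define u where "u = inverse (1 - A s s)"
  have unit: "fps_nth (1 - A s s) 0 \<noteq> 0" using insert.prems(4) by simp
  \<comment> \<open>The pivot is written with a scalar \<open>-1\<close>, so that closure under sums
    and products suffices.\<close>
  have "rational_fps (1 + fps_const (-1) * A s s)"
    using insert.prems(3) rational_fps_const[of 1]
    by (intro rational_fps_add rational_fps_mult rational_fps_const) auto
  then have u: "rational_fps u"
    unfolding u_def using unit by (intro rational_fps_inverse) (simp_all flip: fps_const_neg)
  have "(1 - A s s) * V s = c s + (\<Sum>y\<in>S. A s y * V y)"
    using insert.prems(1)[of s] insert.hyps by (simp add: algebra_simps)
  then have "u * ((1 - A s s) * V s) = u * (c s + (\<Sum>y\<in>S. A s y * V y))"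
    by simp
  then have Vs: "V s = u * (c s + (\<Sum>y\<in>S. A s y * V y))"
    using inverse_mult_eq_1[OF unit] by (simp add: u_def flip: mult.assoc)
  have IH: "rational_fps (V y)" if "y \<in> S" for y
  \<comment> \<open>Substituting \<open>Vs\<close> into the equations indexed by \<open>S\<close>
    yields this smaller system; the correction \<open>A x s * u * A s y\<close> is the Schur
    complement term.\<close>
  proof (rule insert.IH[of "\<lambda>x. c x + A x s * u * c s" "\<lambda>x y. A x y + A x s * u * A s y"])
    show "V x = c x + A x s * u * c s + (\<Sum>y\<in>S. (A x y + A x s * u * A s y) * V y)"
      if "x \<in> S" for x
    proof -
      have "V x = c x + A x s * V s + (\<Sum>y\<in>S. A x y * V y)"
        using insert.prems(1)[of x] insert.hyps that by (simp add: add.assoc)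
      then show ?thesis
        by (subst (asm) Vs)
           (simp add: algebra_simps sum.distrib sum_distrib_left)
    qed
  qed (use insert.prems(2-4) u that in \<open>auto intro!: rational_fps_add rational_fps_mult\<close>)
  have "rational_fps (V s)"
    by (subst Vs) (use insert.prems(2-4) u IH in
      \<open>auto intro!: rational_fps_add rational_fps_mult rational_fps_sum\<close>)
  then show ?case using IH insert.prems(5) by auto
qed

text \<open>This passes from formal series to functions: polynomials expand to their own
  coefficients, and the reciprocal of \<open>q\<close> has an expansion because \<open>q\<close> is
  nonzero at the origin.\<close>

lemma rational_fps_expansion:
  fixes F :: "complex fps"
  assumes "rational_fps F"
  obtains p q where "poly q 0 \<noteq> 0" "(\<lambda>z. poly p z / poly q z) has_fps_expansion F"
proof -
  obtain p q where *: "poly q 0 \<noteq> 0" "F * fps_of_poly q = fps_of_poly p"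
    using assms unfolding rational_fps_def by blast
  have q0: "fps_nth (fps_of_poly q) 0 \<noteq> 0" using * by (simp add: poly_0_coeff_0)
  have poly: "poly r has_fps_expansion fps_of_poly r" for r :: "complex poly"
    by (induction r) (auto simp: fps_of_poly_pCons add.commute mult.commute
        intro!: fps_expansion_intros)
  have "F = F * fps_of_poly q * inverse (fps_of_poly q)"
    using inverse_mult_eq_1'[OF q0] by (simp add: mult.assoc)
  then have "F = fps_of_poly p * inverse (fps_of_poly q)"
    by (simp add: *)
  moreover have "(\<lambda>z. poly p z * inverse (poly q z)) has_fps_expansion
      fps_of_poly p * inverse (fps_of_poly q)"
    using q0 by (intro has_fps_expansion_mult has_fps_expansion_inverse poly)
  ultimately show ?thesis using that[of q p] * by (simp add: divide_inverse)
qed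

context group begin

text \<open>This is the fibre of the holonomy data over its first entry. The target \<open>x\<close>
  is not confined to a conjugacy class, since removing a factor can lead out of \<mu>.\<close>

definition factorizations :: "'a set \<Rightarrow> 'a set \<Rightarrow> nat \<Rightarrow> 'a \<Rightarrow> ('a list \<times> 'a) set" where
  "factorizations \<tau> \<nu> r x =
     {(ts, b). length ts = r \<and> set ts \<subseteq> \<tau> \<and> b \<in> \<nu> \<and> x = foldr (\<otimes>) ts \<one> \<otimes> b}"

lemma finite_factorizations:
  assumes "finite \<tau>" "finite \<nu>"
  shows "finite (factorizations \<tau> \<nu> r x)"
  by (rule finite_subset[of _ "{ts. set ts \<subseteq> \<tau> \<and> length ts = r} \<times> \<nu>"])
     (use assms finite_lists_length_eq in \<open>auto simp: factorizations_def\<close>)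

lemma card_factorizations_0:
  assumes "\<nu> \<subseteq> carrier G"
  shows "card (factorizations \<tau> \<nu> 0 x) = (if x \<in> \<nu> then 1 else 0)"
proof -
  have "factorizations \<tau> \<nu> 0 x = (if x \<in> \<nu> then {([], x)} else {})"
    using assms by (auto simp: factorizations_def)
  then show ?thesis by simp
qed

lemma card_factorizations_Suc:
  assumes "finite \<tau>" "finite \<nu>" "\<tau> \<subseteq> carrier G" "\<nu> \<subseteq> carrier G" "x \<in> carrier G"
  shows "card (factorizations \<tau> \<nu> (Suc r) x)
    = (\<Sum>t\<in>\<tau>. card (factorizations \<tau> \<nu> r (inv t \<otimes> x)))"
proof -
  \<comment> \<open>Since \<open>foldr\<close> puts the head of the list leftmost, removing it
    amounts to left multiplication by \<open>inv t\<close>.\<close>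
  have split: "x = t \<otimes> y \<otimes> b \<longleftrightarrow> inv t \<otimes> x = y \<otimes> b"
    if "t \<in> \<tau>" "y \<in> carrier G" "b \<in> \<nu>" for t y b
  proof -
    have "t \<in> carrier G" "b \<in> carrier G" using that assms by auto
    then show ?thesis
      using that(2) assms(5) inv_solve_left'[of "y \<otimes> b" t x] by (simp add: m_assoc)
  qed
  have Cons: "(t # ts, b) \<in> factorizations \<tau> \<nu> (Suc r) x \<longleftrightarrow>
      t \<in> \<tau> \<and> (ts, b) \<in> factorizations \<tau> \<nu> r (inv t \<otimes> x)" for t ts b
  proof (cases "t \<in> \<tau> \<and> set ts \<subseteq> \<tau> \<and> b \<in> \<nu>")
    case True
    then have "foldr (\<otimes>) ts \<one> \<in> carrier G"
      using assms by (intro foldr_closed) auto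
    with True show ?thesis
      by (simp add: factorizations_def split)
  qed (auto simp: factorizations_def)
  have "bij_betw (\<lambda>(t, ts, b). (t # ts, b))
      (SIGMA t:\<tau>. factorizations \<tau> \<nu> r (inv t \<otimes> x)) (factorizations \<tau> \<nu> (Suc r) x)"
    unfolding bij_betw_def
  proof
    show "inj_on (\<lambda>(t, ts, b). (t # ts, b)) (SIGMA t:\<tau>. factorizations \<tau> \<nu> r (inv t \<otimes> x))"
      by (auto simp: inj_on_def)
    show "(\<lambda>(t, ts, b). (t # ts, b)) ` (SIGMA t:\<tau>. factorizations \<tau> \<nu> r (inv t \<otimes> x))
        = factorizations \<tau> \<nu> (Suc r) x"
    proof (rule subset_antisym)
      show "factorizations \<tau> \<nu> (Suc r) x
          \<subseteq> (\<lambda>(t, ts, b). (t # ts, b)) ` (SIGMA t:\<tau>. factorizations \<tau> \<nu> r (inv t \<otimes> x))"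
      proof
        fix z assume z: "z \<in> factorizations \<tau> \<nu> (Suc r) x"
        then obtain t ts b where "z = (t # ts, b)"
          by (auto simp: factorizations_def length_Suc_conv)
        with z show "z \<in> (\<lambda>(t, ts, b). (t # ts, b)) `
            (SIGMA t:\<tau>. factorizations \<tau> \<nu> r (inv t \<otimes> x))"
          by (force simp: Cons)
      qed
    qed (auto simp: Cons)
  qed
  then have "card (factorizations \<tau> \<nu> (Suc r) x)
      = card (SIGMA t:\<tau>. factorizations \<tau> \<nu> r (inv t \<otimes> x))"
    by (simp add: bij_betw_same_card)
  then show ?thesis using assms finite_factorizations by simp
qed

lemma rational_fps_card_factorizations:
  assumes fin: "finite (carrier G)" and sub: "\<tau> \<subseteq> carrier G" "\<nu> \<subseteq> carrier G"
    and x: "x \<in> carrier G"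
  shows "rational_fps (Abs_fps (\<lambda>r. of_nat (card (factorizations \<tau> \<nu> r x))) :: 'k::field fps)"
proof -
  define V :: "'a \<Rightarrow> 'k fps"
    where "V x = Abs_fps (\<lambda>r. of_nat (card (factorizations \<tau> \<nu> r x)))" for x
  define c :: "'a \<Rightarrow> 'k fps" where "c x = fps_const (if x \<in> \<nu> then 1 else 0)" for x
  have c: "rational_fps (c x)" for x by (simp only: c_def rational_fps_const)
  \<comment> \<open>The factor \<open>fps_X\<close> accounts for the shift from \<open>r\<close> to
    \<open>Suc r\<close>, and it supplies the vanishing constant terms that elimination
    requires.\<close>
  define A :: "'a \<Rightarrow> 'a \<Rightarrow> 'k fps"
    where "A x y = fps_X * fps_const (of_nat (card {t\<in>\<tau>. inv t \<otimes> x = y}))" for x y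
  have fins: "finite \<tau>" "finite \<nu>" using fin sub finite_subset by blast+
  have "rational_fps (V x)"
  proof (rule rational_fps_linear_system[OF fin _ _ _ _ x])
    fix x assume x: "x \<in> carrier G"
    have "fps_nth (V x) (Suc r) =
        (\<Sum>y\<in>carrier G. of_nat (card {t\<in>\<tau>. inv t \<otimes> x = y}) * fps_nth (V y) r)" for r
    proof -
      have "fps_nth (V x) (Suc r) = (\<Sum>t\<in>\<tau>. fps_nth (V (inv t \<otimes> x)) r)"
        by (simp add: V_def card_factorizations_Suc fins sub x)
      \<comment> \<open>The factors \<open>t\<close> are grouped by the element \<open>y\<close>
        they lead to, which turns the recursion into a matrix product over the whole group.\<close>
      also have "\<dots> = (\<Sum>y\<in>carrier G. \<Sum>t | t \<in> \<tau> \<and> inv t \<otimes> x = y. fps_nth (V (inv t \<otimes> x)) r)"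
        using fin fins sub x by (intro sum.group[symmetric]) auto
      finally show ?thesis by simp
    qed
    moreover have "fps_nth (V x) 0 = (if x \<in> \<nu> then 1 else 0)"
      using sub by (simp add: V_def card_factorizations_0)
    ultimately have "fps_nth (V x) n = fps_nth (c x + (\<Sum>y\<in>carrier G. A x y * V y)) n" for n
      \<comment> \<open>The coefficient at 0 comes from \<open>c\<close> alone, and those at
        \<open>Suc r\<close> come from the recursion.\<close>
      by (cases n) (simp_all add: c_def A_def fps_sum_nth mult.assoc)
    then show "V x = c x + (\<Sum>y\<in>carrier G. A x y * V y)"
      by (rule fps_ext)
  qed (auto simp: A_def intro!: c rational_fps_const rational_fps_mult rational_fps_X)
  then show ?thesis by (simp add: V_def)
qed

lemma card_holonomy_data:
  assumes "finite \<mu>" "finite \<tau>" "finite \<nu>"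
  shows "card (holonomy_data G \<tau> \<mu> \<nu> r) = (\<Sum>a\<in>\<mu>. card (factorizations \<tau> \<nu> r a))"
proof -
  have "holonomy_data G \<tau> \<mu> \<nu> r = (SIGMA a:\<mu>. factorizations \<tau> \<nu> r a)"
    by (auto simp: holonomy_data_def factorizations_def)
  then show ?thesis using assms finite_factorizations by simp
qed

end

theorem corollary5p5:
  fixes G :: "('a, 'b) monoid_scheme" (structure)
    and \<mu> \<nu> \<tau> :: "'a set"
  assumes "group G" and "finite (carrier G)"
    and "\<mu> \<in> conj_classes G" and "\<nu> \<in> conj_classes G" and "\<tau> \<in> conj_classes G"
  shows "\<exists>p q :: complex poly. poly q 0 \<noteq> 0 \<and>
    (\<lambda>\<beta>. poly p \<beta> / poly q \<beta>) has_fps_expansion hurwitz_gf G \<tau> \<mu> \<nu>"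
proof -
  interpret group G by fact
  have sub: "\<mu> \<subseteq> carrier G" "\<nu> \<subseteq> carrier G" "\<tau> \<subseteq> carrier G"
    using assms conj_class_subset by auto
  then have fin: "finite \<mu>" "finite \<nu>" "finite \<tau>"
    using assms(2) finite_subset by blast+
  \<comment> \<open>Sorting the holonomy data by the first entry \<open>a\<close> leaves a finite
    sum of rational series, scaled by a constant.\<close>
  have "hurwitz_gf G \<tau> \<mu> \<nu> = fps_const (1 / of_nat (order G)) *
      (\<Sum>a\<in>\<mu>. Abs_fps (\<lambda>r. of_nat (card (factorizations \<tau> \<nu> r a))))"
    by (rule fps_ext)
       (simp add: hurwitz_gf_def hurwitz_number_def card_holonomy_data fin fps_sum_nth
         of_rat_divide of_rat_sum)
  then have "rational_fps (hurwitz_gf G \<tau> \<mu> \<nu>)"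
    using assms(2) sub
    by (auto intro!: rational_fps_mult rational_fps_const rational_fps_sum
        rational_fps_card_factorizations)
  then show ?thesis
    by (rule rational_fps_expansion) blast
qed

end
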